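(* Let $\widetilde\Gamma$ be a simply-laced extended Dynkin graph with Weyl group $\widetilde W$, positive real roots $\widetilde\Delta_+$, and let $P_{\widetilde\Gamma}$ be the dual of the root lattice $R_{\widetilde\Gamma}$. For nonzero $\lambda\in P_{\widetilde\Gamma}$, there exists a $\lambda$-minuscule element $w\in\widetilde W$ such that $w(\lambda)$ is dominant if and only if (i) $\alpha\cdot\lambda\ge -1$ for all $\alpha\in\widetilde\Delta_+$, and (ii) $\delta\cdot\lambda\ne 0$.
   Context: A simply-laced extended Dynkin graph is a graph (without loops or multiple edges) of type $\widetilde A_n$ ($n\ge 2$, a cycle), $\widetilde D_n$ ($n\ge4$), $\widetilde E_6$, $\widetilde E_7$ or $\widetilde E_8$, with vertex set $\widetilde I$ and simple roots $\alpha_i$ ($i\in\widetilde I$). The root lattice is $R_{\widetilde\Gamma}=\bigoplus_{i}\mathbb{Z}\alpha_i$, with Cartan form $\langle \alpha_i,\alpha_i\rangle=2$, $\langle\alpha_i,\alpha_j\rangle=-1$ if $i,j$ are adjacent, and $0$ otherwise (positive semidefinite). $\widetilde\Delta_+$ is the set of positive real roots: the nonnegative-integer combinations $\alpha$ of simple roots with $\langle\alpha,\alpha\rangle=2$. $\delta\in R_{\widetilde\Gamma}$ is the positive-integral combination of simple roots which generates the kernel of the Cartan form. $P_{\widetilde\Gamma}=\mathrm{Hom}(R_{\widetilde\Gamma},\mathbb{Z})$, and $\alpha\cdot\lambda$ denotes the pairing of $\alpha\in R_{\widetilde\Gamma}$ with $\lambda\in P_{\widetilde\Gamma}$. For $\alpha\in\widetilde\Delta_+$,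 $\alpha^\vee\in P_{\widetilde\Gamma}$ is the element with $\beta\cdot\alpha^\vee=\langle\beta,\alpha\rangle$ for all $\beta\in\widetilde\Delta_+$. $\widetilde W$ is generated by the simple reflections $s_i$, acting on $P_{\widetilde\Gamma}$ by $s_i(\lambda)=\lambda-(\alpha_i\cdot\lambda)\alpha_i^\vee$. An element $\lambda$ is dominant if $\alpha_i\cdot\lambda\ge0$ for all $i\in\widetilde I$. An element $w\in\widetilde W$ is $\lambda$-minuscule if there is a reduced expression $w=s_{i_1}s_{i_2}\cdots s_{i_t}$ ($t\ge 0$) such that $s_{i_r}s_{i_{r+1}}\cdots s_{i_t}\lambda=\lambda+\alpha_{i_r}^\vee+\cdots+\alpha_{i_t}^\vee$ for all $r\in\{1,\dots,t\}$. *)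

theory Defs
  imports "HOL-Analysis.Finite_Cartesian_Product" "HOL-Analysis.Cartesian_Space"
    "HOL-Algebra.Bij" "HOL-Algebra.Generated_Groups"
begin

section \<open>Simply-laced extended Dynkin graphs\<close>

text \<open>
  A graph is given by its adjacency relation on a finite type \<open>'v\<close>, the vertex set.
  In the list describing type \<open>X\<^sub>n\<close> extended, the vertices are \<open>0, \<dots>, n\<close>, each edge is listed once
  in an arbitrary direction, and (except in the cyclic type) Bourbaki's numbering is used, with
  \<open>0\<close> the extending vertex.
\<close>

definition edges_A :: "nat \<Rightarrow> (nat \<times> nat) set" where
  "edges_A n = {(i, (i + 1) mod (n + 1)) | i. i \<le> n}"

definition edges_D :: "nat \<Rightarrow> (nat \<times> nat) set" where
  "edges_D n = {(0, 2), (n - 2, n)} \<union> {(i, i + 1) | i. 1 \<le> i \<and> i \<le> n - 2}"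

definition edges_E6 :: "(nat \<times> nat) set" where
  "edges_E6 = {(1, 3), (3, 4), (4, 5), (5, 6), (4, 2), (2, 0)}"

definition edges_E7 :: "(nat \<times> nat) set" where
  "edges_E7 = {(0, 1), (1, 3), (3, 4), (4, 5), (5, 6), (6, 7), (4, 2)}"

definition edges_E8 :: "(nat \<times> nat) set" where
  "edges_E8 = {(1, 3), (3, 4), (4, 5), (5, 6), (6, 7), (7, 8), (8, 0), (4, 2)}"

definition graph_of_shape :: "('v \<Rightarrow> 'v \<Rightarrow> bool) \<Rightarrow> nat \<Rightarrow> (nat \<times> nat) set \<Rightarrow> bool" where
  "graph_of_shape adj n D \<longleftrightarrow>
     (\<exists>f. bij_betw f UNIV {0..n} \<and> (\<forall>i j. adj i j \<longleftrightarrow> (f i, f j) \<in> D \<or> (f j, f i) \<in> D))"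

definition simply_laced_extended_Dynkin :: "('v::finite \<Rightarrow> 'v \<Rightarrow> bool) \<Rightarrow> bool" where
  "simply_laced_extended_Dynkin adj \<longleftrightarrow>
     (\<exists>n\<ge>2. graph_of_shape adj n (edges_A n)) \<or>
     (\<exists>n\<ge>4. graph_of_shape adj n (edges_D n)) \<or>
     graph_of_shape adj 6 edges_E6 \<or>
     graph_of_shape adj 7 edges_E7 \<or>
     graph_of_shape adj 8 edges_E8"

section \<open>Root lattice\<close>

text \<open>The root lattice is \<open>int ^ 'v\<close>; coordinates are taken in the basis of simple roots.\<close>

abbreviation simple_root :: "'v::finite \<Rightarrow> int ^ 'v" where
  "simple_root i \<equiv> axis i 1"

definition cartan :: "('v \<Rightarrow> 'v \<Rightarrow> bool) \<Rightarrow> 'v \<Rightarrow> 'v \<Rightarrow> int" where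
  "cartan adj i j = (if i = j then 2 else if adj i j then -1 else 0)"

definition cartan_form :: "('v::finite \<Rightarrow> 'v \<Rightarrow> bool) \<Rightarrow> int ^ 'v \<Rightarrow> int ^ 'v \<Rightarrow> int" where
  "cartan_form adj x y = (\<Sum>i\<in>UNIV. \<Sum>j\<in>UNIV. x $ i * y $ j * cartan adj i j)"

lemma cartan_form_simple_root:
  "cartan_form adj (simple_root i) (simple_root j) = cartan adj i j"
proof -
  have "cartan_form adj (simple_root i) (simple_root j) =
      (\<Sum>a\<in>UNIV. \<Sum>b\<in>UNIV. if b = j then if a = i then cartan adj a b else 0 else 0)"
    unfolding cartan_form_def by (intro sum.cong refl) (simp add: axis_def)
  then show ?thesis
    by simp
qed

definition positive_real_roots :: "('v::finite \<Rightarrow> 'v \<Rightarrow> bool) \<Rightarrow> (int ^ 'v) set" where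
  "positive_real_roots adj = {\<alpha>. (\<forall>i. 0 \<le> \<alpha> $ i) \<and> cartan_form adj \<alpha> \<alpha> = 2}"

definition delta :: "('v::finite \<Rightarrow> 'v \<Rightarrow> bool) \<Rightarrow> int ^ 'v" where
  "delta adj = (THE d. (\<forall>i. 0 < d $ i) \<and>
      {x. \<forall>y. cartan_form adj x y = 0} = range (\<lambda>k. k *s d))"

section \<open>The dual of the root lattice\<close>

typedef (overloaded) ('v::finite) weight = "{f :: int ^ 'v \<Rightarrow> int. additive f}"
  morphisms eval_weight Weight
  by (rule exI[of _ "\<lambda>_. 0"]) (simp add: additive_def)

setup_lifting type_definition_weight

definition pairing :: "int ^ 'v::finite \<Rightarrow> 'v weight \<Rightarrow> int"  (infixl "\<cdot>" 70) where
  "\<alpha> \<cdot> \<mu> = eval_weight \<mu> \<alpha>"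

instantiation weight :: (finite) ab_group_add
begin

lift_definition zero_weight :: "'a weight" is "\<lambda>_. 0"
  by (simp add: additive_def)

lift_definition plus_weight :: "'a weight \<Rightarrow> 'a weight \<Rightarrow> 'a weight" is "\<lambda>f g x. f x + g x"
  by (simp add: additive_def)

lift_definition uminus_weight :: "'a weight \<Rightarrow> 'a weight" is "\<lambda>f x. - f x"
  by (simp add: additive_def)

lift_definition minus_weight :: "'a weight \<Rightarrow> 'a weight \<Rightarrow> 'a weight" is "\<lambda>f g x. f x - g x"
  by (simp add: additive_def)

instance
  by standard (transfer; simp add: fun_eq_iff)+

end

lift_definition scale_weight :: "int \<Rightarrow> 'v::finite weight \<Rightarrow> 'v weight"  (infixr "*\<^sub>P" 75)
  is "\<lambda>c f x. c * f x"
  by (simp add: additive_def distrib_left)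

lemma weight_eqI: "(\<And>\<alpha>. \<alpha> \<cdot> \<mu> = \<alpha> \<cdot> \<nu>) \<Longrightarrow> \<mu> = \<nu>"
  unfolding pairing_def by transfer auto

lemma pairing_simps [simp]:
  "\<alpha> \<cdot> 0 = 0"
  "\<alpha> \<cdot> (\<mu> + \<nu>) = \<alpha> \<cdot> \<mu> + \<alpha> \<cdot> \<nu>"
  "\<alpha> \<cdot> (- \<mu>) = - (\<alpha> \<cdot> \<mu>)"
  "\<alpha> \<cdot> (\<mu> - \<nu>) = \<alpha> \<cdot> \<mu> - \<alpha> \<cdot> \<nu>"
  "\<alpha> \<cdot> (c *\<^sub>P \<mu>) = c * (\<alpha> \<cdot> \<mu>)"
  unfolding pairing_def by (transfer; simp)+

lift_definition coroot :: "('v::finite \<Rightarrow> 'v \<Rightarrow> bool) \<Rightarrow> int ^ 'v \<Rightarrow> 'v weight"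
  is "\<lambda>adj \<alpha> \<beta>. cartan_form adj \<beta> \<alpha>"
  by (simp add: additive_def cartan_form_def distrib_right sum.distrib)

lemma pairing_coroot [simp]: "\<beta> \<cdot> coroot adj \<alpha> = cartan_form adj \<beta> \<alpha>"
  unfolding pairing_def by transfer simp

definition dominant :: "'v::finite weight \<Rightarrow> bool" where
  "dominant \<mu> \<longleftrightarrow> (\<forall>i. 0 \<le> simple_root i \<cdot> \<mu>)"

section \<open>Weyl group\<close>

definition simple_reflection ::
    "('v::finite \<Rightarrow> 'v \<Rightarrow> bool) \<Rightarrow> 'v \<Rightarrow> 'v weight \<Rightarrow> 'v weight" where
  "simple_reflection adj i \<mu> = \<mu> - (simple_root i \<cdot> \<mu>) *\<^sub>P coroot adj (simple_root i)"

text \<open>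
  The Weyl group is realised through its (faithful) action on the dual of the root lattice.
\<close>

definition weyl_group :: "('v::finite \<Rightarrow> 'v \<Rightarrow> bool) \<Rightarrow> ('v weight \<Rightarrow> 'v weight) set" where
  "weyl_group adj = generate (BijGroup UNIV) (range (simple_reflection adj))"

lemma simple_reflection_involution:
  "simple_reflection adj i (simple_reflection adj i \<mu>) = \<mu>"
  by (rule weight_eqI)
     (simp add: simple_reflection_def cartan_form_simple_root cartan_def algebra_simps)

lemma simple_reflection_in_carrier: "simple_reflection adj i \<in> carrier (BijGroup UNIV)"
  unfolding BijGroup_def Bij_def
  by (auto intro!: o_bij[of "simple_reflection adj i"] simp: fun_eq_iff simple_reflection_involution)

definition word_product ::
    "('v::finite \<Rightarrow> 'v \<Rightarrow> bool) \<Rightarrow> 'v list \<Rightarrow> 'v weight \<Rightarrow> 'v weight" where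
  "word_product adj is = foldr (\<lambda>i w. simple_reflection adj i \<circ> w) is id"

definition reduced_expression ::
    "('v::finite \<Rightarrow> 'v \<Rightarrow> bool) \<Rightarrow> 'v list \<Rightarrow> ('v weight \<Rightarrow> 'v weight) \<Rightarrow> bool" where
  "reduced_expression adj is w \<longleftrightarrow>
     word_product adj is = w \<and> (\<forall>js. word_product adj js = w \<longrightarrow> length is \<le> length js)"

definition minuscule ::
    "('v::finite \<Rightarrow> 'v \<Rightarrow> bool) \<Rightarrow> 'v weight \<Rightarrow> ('v weight \<Rightarrow> 'v weight) \<Rightarrow> bool" where
  "minuscule adj \<mu> w \<longleftrightarrow>
     (\<exists>is. reduced_expression adj is w \<and>
        (\<forall>r < length is. word_product adj (drop r is) \<mu> =
            \<mu> + (\<Sum>i\<leftarrow>drop r is. coroot adj (simple_root i))))"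

end

theory Submission
  imports Defs
begin

text \<open>
  Prepending a letter \<open>i\<close> to a minuscule word means reflecting at a vertex where the current weight
  takes the value \<open>-1\<close>. As \<open>s\<^sub>i\<close> permutes the positive real roots other than \<open>\<alpha>\<^sub>i\<close>, such a move
  preserves condition (i) in both directions. It also fixes \<open>\<delta> \<cdot> \<mu>\<close>, and a dominant weight that
  vanishes on \<open>\<delta>\<close> is \<open>0\<close>; so a minuscule path to a dominant weight forces (i) and (ii).

  Conversely, \<open>\<alpha>\<^sub>i + k \<delta>\<close> is a positive real root for all \<open>k \<ge> 0\<close>, so (i) and (ii) give \<open>\<delta> \<cdot> \<mu> > 0\<close>.
  Since there are finitely many real roots modulo \<open>\<delta>\<close>, only finitely many positive real roots are
  negative on \<open>\<mu>\<close>. By (i), every simple root that is negative on the current weight has value \<open>-1\<close>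
  there, and reflecting in it removes exactly one negative root: any sequence of such moves ends at
  a dominant weight. An arbitrary simple reflection removes at most one negative root, so the
  resulting word is reduced.
\<close>

section \<open>The Cartan form and the pairing\<close>

lemma cartan_form_add_left: "cartan_form adj (x + y) z = cartan_form adj x z + cartan_form adj y z"
  by (simp add: cartan_form_def distrib_right sum.distrib)

lemma cartan_form_add_right: "cartan_form adj z (x + y) = cartan_form adj z x + cartan_form adj z y"
  by (simp add: cartan_form_def distrib_right distrib_left sum.distrib)

lemma cartan_form_scale_left: "cartan_form adj (k *s x) z = k * cartan_form adj x z"
  by (simp add: cartan_form_def sum_distrib_left mult_ac)

lemma cartan_form_scale_right: "cartan_form adj z (k *s x) = k * cartan_form adj z x"
  by (simp add: cartan_form_def sum_distrib_left mult_ac)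

lemma cartan_form_diff_left: "cartan_form adj (x - y) z = cartan_form adj x z - cartan_form adj y z"
  by (metis add_diff_cancel_right' cartan_form_add_left diff_add_cancel)

lemma cartan_form_diff_right: "cartan_form adj z (x - y) = cartan_form adj z x - cartan_form adj z y"
  by (metis add_diff_cancel_right' cartan_form_add_right diff_add_cancel)

lemmas cartan_form_bilinear =
  cartan_form_add_left cartan_form_add_right cartan_form_scale_left cartan_form_scale_right
  cartan_form_diff_left cartan_form_diff_right

lemma simple_root_nth: "simple_root i $ j = (if j = i then 1 else 0)"
  by (simp add: axis_def)

lemma cartan_form_simple_root_self: "cartan_form adj (simple_root i) (simple_root i) = 2"
  by (simp add: cartan_form_simple_root cartan_def)

lemma cartan_form_simple_root_right:
  "cartan_form adj x (simple_root i) = (\<Sum>j\<in>UNIV. x $ j * cartan adj j i)"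
proof -
  have "cartan_form adj x (simple_root i) =
      (\<Sum>a\<in>UNIV. \<Sum>b\<in>UNIV. if b = i then x $ a * cartan adj a b else 0)"
    unfolding cartan_form_def by (intro sum.cong refl) (simp add: axis_def)
  then show ?thesis
    by simp
qed

lemma additive_pairing: "additive (\<lambda>x. x \<cdot> \<mu>)"
  unfolding pairing_def using eval_weight[of \<mu>] by simp

lemmas pairing_add_left = additive.add[OF additive_pairing]
  and pairing_diff_left = additive.diff[OF additive_pairing]
  and pairing_minus_left = additive.minus[OF additive_pairing]
  and pairing_zero_left = additive.zero[OF additive_pairing]
  and pairing_sum_left = additive.sum[OF additive_pairing]

lemma pairing_scale_left: "(k *s x) \<cdot> \<mu> = k * (x \<cdot> \<mu>)"
proof (induction k rule: int_induct[where k = 0])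
  case base
  then show ?case by (simp add: pairing_zero_left)
next
  case (step1 i)
  then show ?case by (simp add: vector_sadd_rdistrib pairing_add_left distrib_right)
next
  case (step2 i)
  then show ?case by (simp add: vector_ssub_ldistrib vector_sub_rdistrib pairing_diff_left left_diff_distrib)
qed

lemma pairing_expansion: "x \<cdot> \<mu> = (\<Sum>i\<in>UNIV. x $ i * (simple_root i \<cdot> \<mu>))"
proof -
  have "x \<cdot> \<mu> = (\<Sum>i\<in>UNIV. x $ i *s simple_root i) \<cdot> \<mu>"
    by (simp add: basis_expansion)
  then show ?thesis
    by (simp add: pairing_sum_left pairing_scale_left)
qed

lemma dominant_pairing_nonneg:
  assumes "dominant \<mu>" and "\<And>i. 0 \<le> x $ i"
  shows "0 \<le> x \<cdot> \<mu>"
  using assms by (simp add: pairing_expansion[of x] dominant_def sum_nonneg)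

section \<open>Words in the simple reflections\<close>

text \<open>The action of \<open>s\<^sub>i\<close> on the root lattice, adjoint to
  \<open>simple_reflection\<close> under the pairing.\<close>

definition root_reflection ::
    "('v::finite \<Rightarrow> 'v \<Rightarrow> bool) \<Rightarrow> 'v \<Rightarrow> int ^ 'v \<Rightarrow> int ^ 'v" where
  "root_reflection adj i x = x - cartan_form adj x (simple_root i) *s simple_root i"

lemma pairing_simple_reflection:
  "x \<cdot> simple_reflection adj i \<mu> = root_reflection adj i x \<cdot> \<mu>"
  by (simp add: simple_reflection_def root_reflection_def pairing_diff_left pairing_scale_left)

lemma root_reflection_involution:
  "root_reflection adj i (root_reflection adj i x) = x"
  by (simp add: root_reflection_def cartan_form_bilinear cartan_form_simple_root_self)
     (simp add: vec_eq_iff algebra_simps)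

text \<open>With p = \<open>simple_root i \<cdot> \<mu>\<close>, evaluating both sides at
  \<open>simple_root i\<close> gives -p = p + 2.\<close>

lemma simple_reflection_eq_add_coroot_iff:
  "simple_reflection adj i \<mu> = \<mu> + coroot adj (simple_root i) \<longleftrightarrow> simple_root i \<cdot> \<mu> = -1"
proof
  assume "simple_reflection adj i \<mu> = \<mu> + coroot adj (simple_root i)"
  then have "simple_root i \<cdot> simple_reflection adj i \<mu> =
      simple_root i \<cdot> (\<mu> + coroot adj (simple_root i))"
    by simp
  then show "simple_root i \<cdot> \<mu> = -1"
    by (simp add: simple_reflection_def cartan_form_simple_root_self)
next
  assume "simple_root i \<cdot> \<mu> = -1"
  then show "simple_reflection adj i \<mu> = \<mu> + coroot adj (simple_root i)"
    by (intro weight_eqI) (simp add: simple_reflection_def)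
qed

lemma word_product_simps [simp]:
  "word_product adj [] \<mu> = \<mu>"
  "word_product adj (i # is) \<mu> = simple_reflection adj i (word_product adj is \<mu>)"
  by (simp_all add: word_product_def)

lemma word_product_append:
  "word_product adj (is @ js) \<mu> = word_product adj is (word_product adj js \<mu>)"
  by (induction "is") auto

text \<open>Reflections fix 0 and are involutions, so nothing but 0 is sent to 0.\<close>

lemma word_product_eq_0: "word_product adj is \<mu> = 0 \<Longrightarrow> \<mu> = 0"
proof (induction "is")
  case (Cons i "is")
  have "word_product adj is \<mu> = simple_reflection adj i 0"
    using Cons.prems by (simp flip: Cons.prems add: simple_reflection_involution)
  also have "\<dots> = 0"
    by (intro weight_eqI) (simp add: simple_reflection_def)
  finally show ?case
    using Cons.IH by blast
qed simp

lemma word_product_in_weyl_group: "word_product adj is \<in> weyl_group adj"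
proof (induction "is")
  case Nil
  have "\<one>\<^bsub>BijGroup UNIV\<^esub> \<in> weyl_group adj"
    unfolding weyl_group_def by (rule generate.one)
  then show ?case
    by (simp add: BijGroup_def word_product_def restrict_def id_def)
next
  case (Cons i "is")
  have "simple_reflection adj i \<otimes>\<^bsub>BijGroup UNIV\<^esub> word_product adj is \<in> weyl_group adj"
    using Cons unfolding weyl_group_def by (intro generate.eng[OF generate.incl]) auto
  \<comment> \<open>The product of \<open>BijGroup UNIV\<close> is restricted to its carrier, so
    both factors must lie there before it unfolds to composition.\<close>
  moreover have "word_product adj is \<in> carrier (BijGroup UNIV)"
  proof -
    have "generate (BijGroup UNIV) (range (simple_reflection adj)) \<subseteq> carrier (BijGroup UNIV)"
      by (intro group.generate_incl group_BijGroup) (auto simp: simple_reflection_in_carrier)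
    then show ?thesis
      using Cons unfolding weyl_group_def by blast
  qed
  ultimately show ?case
    using simple_reflection_in_carrier[of adj i]
    by (simp add: BijGroup_def word_product_def compose_def restrict_def comp_def)
qed

text \<open>The chain condition of \<open>minuscule\<close> without reducedness, which is obtained
  separately by counting negative roots.\<close>

definition minuscule_word :: "('v::finite \<Rightarrow> 'v \<Rightarrow> bool) \<Rightarrow> 'v weight \<Rightarrow> 'v list \<Rightarrow> bool" where
  "minuscule_word adj \<mu> is \<longleftrightarrow> (\<forall>r < length is. word_product adj (drop r is) \<mu> =
     \<mu> + (\<Sum>i\<leftarrow>drop r is. coroot adj (simple_root i)))"

lemma minuscule_iff:
  "minuscule adj \<mu> w \<longleftrightarrow> (\<exists>is. reduced_expression adj is w \<and> minuscule_word adj \<mu> is)"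
  by (simp add: minuscule_def minuscule_word_def)

lemma minuscule_word_Nil [simp]: "minuscule_word adj \<mu> []"
  by (simp add: minuscule_word_def)

lemma minuscule_word_product:
  "minuscule_word adj \<mu> is \<Longrightarrow>
    word_product adj is \<mu> = \<mu> + (\<Sum>i\<leftarrow>is. coroot adj (simple_root i))"
  by (cases "is") (auto simp: minuscule_word_def)

text \<open>The nonempty suffixes of \<open>i # is\<close> are the word itself
  (\<open>r = 0\<close>) and those of \<open>is\<close>; the product formula for \<open>is\<close>
  then cancels every coroot but that of \<open>i\<close>.\<close>

lemma minuscule_word_Cons [simp]:
  "minuscule_word adj \<mu> (i # is) \<longleftrightarrow>
    minuscule_word adj \<mu> is \<and> simple_root i \<cdot> word_product adj is \<mu> = -1"
proof -
  have "minuscule_word adj \<mu> (i # is) \<longleftrightarrow> minuscule_word adj \<mu> is \<and>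
      simple_reflection adj i (word_product adj is \<mu>) =
        \<mu> + (coroot adj (simple_root i) + (\<Sum>i\<leftarrow>is. coroot adj (simple_root i)))"
    by (auto simp: minuscule_word_def All_less_Suc2)
  also have "\<dots> \<longleftrightarrow> minuscule_word adj \<mu> is \<and> simple_reflection adj i (word_product adj is \<mu>) =
      word_product adj is \<mu> + coroot adj (simple_root i)"
    by (auto simp: minuscule_word_product add_ac)
  finally show ?thesis
    by (simp add: simple_reflection_eq_add_coroot_iff)
qed

lemma minuscule_word_append:
  "minuscule_word adj \<mu> (is @ js) \<longleftrightarrow>
    minuscule_word adj \<mu> js \<and> minuscule_word adj (word_product adj js \<mu>) is"
  by (induction "is") (auto simp: word_product_append)

section \<open>Affine graphs\<close>

text \<open>The common core of the five families: \<open>harmonic\<close> puts the positive vector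
  \<open>d\<close> in the kernel of the Cartan form, and \<open>d_z\<close> makes it primitive, so
  that it is \<delta>.\<close>

locale affine_graph =
  fixes adj :: "'v::finite \<Rightarrow> 'v \<Rightarrow> bool" and z :: 'v and d :: "int ^ 'v"
  assumes sym: "adj i j \<Longrightarrow> adj j i"
    and irrefl: "\<not> adj i i"
    and connected: "adj\<^sup>*\<^sup>* z i"
    and d_pos: "0 < d $ i"
    and d_z: "d $ z = 1"
    and harmonic: "(\<Sum>j | adj i j. d $ j) = 2 * d $ i"
begin

lemma cartan_commute: "cartan adj i j = cartan adj j i"
  using sym by (auto simp: cartan_def)

lemma cartan_form_commute: "cartan_form adj x y = cartan_form adj y x"
  unfolding cartan_form_def
  by (subst sum.swap) (intro sum.cong refl, simp add: cartan_commute mult_ac)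

text \<open>Stated over any ring: it is applied to integers in \<open>cartan_form_d\<close> and to
  reals in \<open>cartan_form_Dirichlet\<close>.\<close>

lemma sum_cartan:
  fixes f :: "'v \<Rightarrow> 'a::ring_1"
  shows "(\<Sum>j\<in>UNIV. f j * of_int (cartan adj i j)) = 2 * f i - (\<Sum>j | adj i j. f j)"
proof -
  have "(\<Sum>j\<in>UNIV. f j * of_int (cartan adj i j)) =
      (\<Sum>j\<in>UNIV. (if i = j then 2 * f i else 0) - (if adj i j then f j else 0))"
    by (intro sum.cong refl) (auto simp: cartan_def irrefl mult_2 mult_2_right)
  then show ?thesis
    by (simp add: sum_subtractf sum.If_cases)
qed

lemma cartan_form_d [simp]: "cartan_form adj x d = 0" "cartan_form adj d x = 0"
proof -
  have "cartan_form adj x d = (\<Sum>i\<in>UNIV. x $ i * (\<Sum>j\<in>UNIV. d $ j * of_int (cartan adj i j)))"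
    by (simp add: cartan_form_def sum_distrib_left mult_ac)
  then show "cartan_form adj x d = 0"
    by (simp only: sum_cartan harmonic) simp
  then show "cartan_form adj d x = 0"
    by (simp add: cartan_form_commute)
qed

text \<open>
  As \<open>d\<close> is a positive null vector, \<open>2 \<langle>x, x\<rangle>\<close> is the weighted Dirichlet energy of \<open>x / d\<close>.
\<close>

lemma cartan_form_Dirichlet:
  "2 * real_of_int (cartan_form adj x x) =
    (\<Sum>i\<in>UNIV. \<Sum>j | adj i j. of_int (d $ i * d $ j) *
      (of_int (x $ i) / of_int (d $ i) - of_int (x $ j) / of_int (d $ j))\<^sup>2)"
proof -
  define y where "y i = real_of_int (x $ i) / of_int (d $ i)" for i
  define e where "e i = real_of_int (d $ i)" for i
  have x: "real_of_int (x $ i) = e i * y i" for i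
    using d_pos[of i] by (simp add: y_def e_def)
  have harm: "(\<Sum>j | adj i j. e j) = 2 * e i" for i
    using harmonic[of i] unfolding e_def by (metis of_int_mult of_int_numeral of_int_sum)
  have "real_of_int (cartan_form adj x x) =
      (\<Sum>i\<in>UNIV. e i * y i * (\<Sum>j\<in>UNIV. e j * y j * of_int (cartan adj i j)))"
    by (simp add: cartan_form_def sum_distrib_left mult_ac flip: x)
  also have "\<dots> = (\<Sum>i\<in>UNIV. e i * y i * (2 * (e i * y i) - (\<Sum>j | adj i j. e j * y j)))"
    by (simp only: sum_cartan)
  also have "\<dots> = (\<Sum>i\<in>UNIV. 2 * (e i * y i)\<^sup>2) - (\<Sum>i\<in>UNIV. \<Sum>j | adj i j. e i * y i * (e j * y j))"
    by (simp add: right_diff_distrib sum_subtractf power2_eq_square sum_distrib_left mult_ac)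
  finally have q: "real_of_int (cartan_form adj x x) = \<dots>" .
  \<comment> \<open>Expanding the squares gives two diagonal sums and a cross term: symmetry of
    adjacency identifies the two sums, and harmonicity evaluates them.\<close>
  have swap: "(\<Sum>i\<in>UNIV. \<Sum>j | adj i j. e i * e j * (y j)\<^sup>2) = (\<Sum>i\<in>UNIV. \<Sum>j | adj i j. e i * e j * (y i)\<^sup>2)"
    (is "?l = ?r")
  proof -
    have "?l = (\<Sum>i\<in>UNIV. \<Sum>j\<in>UNIV. if adj i j then e i * e j * (y j)\<^sup>2 else 0)"
      by (simp add: sum.If_cases)
    also have "\<dots> = (\<Sum>j\<in>UNIV. \<Sum>i\<in>UNIV. if adj i j then e i * e j * (y j)\<^sup>2 else 0)"
      by (rule sum.swap)
    also have "\<dots> = (\<Sum>j\<in>UNIV. \<Sum>i\<in>UNIV. if adj j i then e j * e i * (y j)\<^sup>2 else 0)"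
      by (intro sum.cong refl) (auto dest: sym)
    also have "\<dots> = ?r"
      by (simp add: sum.If_cases)
    finally show ?thesis .
  qed
  have diag: "(\<Sum>i\<in>UNIV. \<Sum>j | adj i j. e i * e j * (y i)\<^sup>2) = (\<Sum>i\<in>UNIV. 2 * (e i * y i)\<^sup>2)"
  proof (intro sum.cong refl)
    fix i
    have "(\<Sum>j | adj i j. e i * e j * (y i)\<^sup>2) = e i * (y i)\<^sup>2 * (\<Sum>j | adj i j. e j)"
      unfolding sum_distrib_left by (simp add: mult_ac)
    then show "(\<Sum>j | adj i j. e i * e j * (y i)\<^sup>2) = 2 * (e i * y i)\<^sup>2"
      by (simp add: harm power2_eq_square)
  qed
  have "(\<Sum>i\<in>UNIV. \<Sum>j | adj i j. e i * e j * (y i - y j)\<^sup>2) =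
      (\<Sum>i\<in>UNIV. \<Sum>j | adj i j. e i * e j * (y i)\<^sup>2 + e i * e j * (y j)\<^sup>2 - 2 * (e i * y i * (e j * y j)))"
    by (intro sum.cong refl) (simp add: power2_eq_square algebra_simps)
  also have "\<dots> = (\<Sum>i\<in>UNIV. 2 * (e i * y i)\<^sup>2) + (\<Sum>i\<in>UNIV. 2 * (e i * y i)\<^sup>2)
      - 2 * (\<Sum>i\<in>UNIV. \<Sum>j | adj i j. e i * y i * (e j * y j))"
    by (simp only: sum.distrib sum_subtractf swap diag sum_distrib_left)
  finally show ?thesis
    by (simp add: q y_def e_def)
qed

text \<open>All terms of the energy are nonnegative, so the total bounds each of them. This controls
  the jump of \<open>x / d\<close> along an edge.\<close>

lemma cartan_form_edge_le:
  assumes "adj i j"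
  shows "of_int (d $ i * d $ j) * (of_int (x $ i) / of_int (d $ i) - of_int (x $ j) / of_int (d $ j))\<^sup>2
    \<le> 2 * real_of_int (cartan_form adj x x)" (is "?t i j \<le> _")
proof -
  have nonneg: "0 \<le> ?t i j" for i j
    using d_pos[of i] d_pos[of j] by simp
  have "?t i j \<le> (\<Sum>j | adj i j. ?t i j)"
    using assms nonneg by (intro member_le_sum) auto
  also have "\<dots> \<le> (\<Sum>i\<in>UNIV. \<Sum>j | adj i j. ?t i j)"
    using nonneg by (intro member_le_sum[of i UNIV "\<lambda>i. \<Sum>j | adj i j. ?t i j"] sum_nonneg) auto
  finally show ?thesis
    by (simp only: cartan_form_Dirichlet)
qed

lemma cartan_form_nonneg: "0 \<le> cartan_form adj x x"
proof -
  have "0 \<le> 2 * real_of_int (cartan_form adj x x)"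
    unfolding cartan_form_Dirichlet using d_pos
    by (intro sum_nonneg mult_nonneg_nonneg) (auto simp: less_imp_le)
  then show ?thesis
    by simp
qed

text \<open>Zero energy makes \<open>x / d\<close> constant along edges, hence on the connected
  graph; its value at \<open>z\<close> is \<open>x $ z\<close> because
  \<open>d $ z = 1\<close>.\<close>

lemma cartan_form_eq_0:
  assumes "cartan_form adj x x = 0"
  shows "x = x $ z *s d"
proof -
  have "real_of_int (x $ i) / of_int (d $ i) = of_int (x $ z)" for i
    using connected[of i]
  proof (induction rule: rtranclp_induct)
    case (step i j)
    have "real_of_int (d $ i * d $ j) * (of_int (x $ i) / of_int (d $ i) - of_int (x $ j) / of_int (d $ j))\<^sup>2 \<le> 0"
      using cartan_form_edge_le[OF step.hyps(2), of x] assms by simp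
    moreover have "0 < real_of_int (d $ i * d $ j)"
      using d_pos by simp
    ultimately have "(real_of_int (x $ i) / of_int (d $ i) - of_int (x $ j) / of_int (d $ j))\<^sup>2 \<le> 0"
      by (meson mult_pos_pos not_le)
    then show ?case
      using step.IH by simp
  qed (simp add: d_z)
  then have "x $ i = x $ z * d $ i" for i
    using d_pos[of i] by (metis less_irrefl nonzero_divide_eq_eq of_int_eq_0_iff of_int_eq_iff of_int_mult)
  then show ?thesis
    unfolding vec_eq_iff vector_smult_component by blast
qed

text \<open>The kernel is generated by \<open>d\<close>. A second positive generator and
  \<open>d\<close> are integer multiples of each other, and positivity excludes the factor
  -1.\<close>

lemma delta_eq: "delta adj = d"
  unfolding delta_def
proof (rule the_equality)
  have ker: "{x. \<forall>y. cartan_form adj x y = 0} = range (\<lambda>k. k *s d)"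
    using cartan_form_eq_0 by (auto simp: cartan_form_bilinear)
  then show "(\<forall>i. 0 < d $ i) \<and> {x. \<forall>y. cartan_form adj x y = 0} = range (\<lambda>k. k *s d)"
    using d_pos by blast
  fix e
  assume e: "(\<forall>i. 0 < e $ i) \<and> {x. \<forall>y. cartan_form adj x y = 0} = range (\<lambda>k. k *s e)"
  have "1 *s e \<in> range (\<lambda>k. k *s d)" and "1 *s d \<in> range (\<lambda>k. k *s e)"
    using e ker by blast+
  then obtain k l where k: "e = k *s d" and l: "d = l *s e"
    by auto
  have e_z: "e $ z = k"
    by (subst k) (simp add: d_z)
  have "d $ z = l * e $ z"
    by (subst l) simp
  then have "k * l = 1"
    by (simp add: e_z d_z mult.commute)
  moreover have "0 < k"
    using e e_z by blast
  ultimately have "k = 1"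
    by (simp add: pos_zmult_eq_1_iff)
  then show "e = d"
    using k by simp
qed

section \<open>Positive real roots\<close>

lemma simple_root_positive: "simple_root i \<in> positive_real_roots adj"
  by (simp add: positive_real_roots_def cartan_form_simple_root_self simple_root_nth)

lemma add_multiple_d_positive:
  assumes "\<alpha> \<in> positive_real_roots adj" and "0 \<le> k"
  shows "\<alpha> + k *s d \<in> positive_real_roots adj"
  using assms d_pos by (auto simp: positive_real_roots_def cartan_form_bilinear less_imp_le)

text \<open>Only coordinate \<open>i\<close> changes, from \<open>a\<close> to \<open>a - c\<close>.
  If \<open>c > a\<close>, deleting the \<open>i\<close>-part of \<alpha> leaves a vector of norm 2
  - 2a(c - a); semidefiniteness makes it a null vector, hence a multiple of \<open>d\<close>, and
  its zero at \<open>i\<close> forces \<alpha> = \<open>simple_root i\<close>.\<close>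

lemma root_reflection_positive:
  assumes \<alpha>: "\<alpha> \<in> positive_real_roots adj" and "\<alpha> \<noteq> simple_root i"
  shows "root_reflection adj i \<alpha> \<in> positive_real_roots adj"
proof -
  define c where "c = cartan_form adj \<alpha> (simple_root i)"
  define a where "a = \<alpha> $ i"
  have nonneg: "0 \<le> \<alpha> $ j" for j
    using \<alpha> by (simp add: positive_real_roots_def)
  have norm: "cartan_form adj \<alpha> \<alpha> = 2"
    using \<alpha> by (simp add: positive_real_roots_def)
  have c': "cartan_form adj (simple_root i) \<alpha> = c"
    by (simp add: c_def cartan_form_commute)
  have "c \<le> a"
  proof (rule ccontr)
    assume "\<not> c \<le> a"
    \<comment> \<open>Having nonnegative coordinates and a zero at \<open>i\<close>, \<beta> pairs
      nonpositively with \<open>simple_root i\<close>. So \<open>c \<le> 2 * a\<close>, which with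
      \<open>c > a\<close> also yields \<open>1 \<le> a\<close>.\<close>
    define \<beta> where "\<beta> = \<alpha> - a *s simple_root i"
    have \<beta>_nth: "\<beta> $ j = (if j = i then 0 else \<alpha> $ j)" for j
      by (simp add: \<beta>_def simple_root_nth a_def)
    have "cartan_form adj \<beta> (simple_root i) \<le> 0"
      unfolding cartan_form_simple_root_right
      by (intro sum_nonpos) (auto simp: \<beta>_nth cartan_def nonneg)
    then have "c \<le> 2 * a"
      by (simp add: \<beta>_def cartan_form_bilinear cartan_form_simple_root_self flip: c_def)
    then have "1 \<le> a" "1 \<le> c - a"
      using \<open>\<not> c \<le> a\<close> by auto
    then have "1 * 1 \<le> a * (c - a)"
      by (intro mult_mono) auto
    moreover have "cartan_form adj \<beta> \<beta> = 2 - 2 * (a * (c - a))"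
      by (simp add: \<beta>_def cartan_form_bilinear cartan_form_simple_root_self norm c' algebra_simps
          flip: c_def)
    ultimately have "cartan_form adj \<beta> \<beta> = 0"
      using cartan_form_nonneg[of \<beta>] by simp
    then have "\<beta> = \<beta> $ z *s d"
      by (rule cartan_form_eq_0)
    moreover have "\<beta> $ i = 0"
      by (simp add: \<beta>_nth)
    ultimately have "\<beta> = 0"
      using d_pos[of i] by (metis less_irrefl mult_eq_0_iff vector_smult_component vector_smult_lzero)
    then have "\<alpha> = a *s simple_root i"
      by (simp add: \<beta>_def)
    then have "2 = a * (a * 2)"
      using norm by (metis cartan_form_scale_left cartan_form_scale_right cartan_form_simple_root_self)
    then have "a * a = 1"
      by simp
    then have "a = 1"
      using \<open>1 \<le> a\<close> by (simp add: zmult_eq_1_iff)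
    then show False
      using \<open>\<alpha> = a *s simple_root i\<close> assms(2) by simp
  qed
  have "0 \<le> root_reflection adj i \<alpha> $ j" for j
    using nonneg[of j] \<open>c \<le> a\<close> by (simp add: root_reflection_def simple_root_nth a_def flip: c_def)
  moreover have "cartan_form adj (root_reflection adj i \<alpha>) (root_reflection adj i \<alpha>) = 2"
    by (simp add: root_reflection_def cartan_form_bilinear cartan_form_simple_root_self norm c'
        flip: c_def)
  ultimately show ?thesis
    by (simp add: positive_real_roots_def)
qed

section \<open>Invariance of the pairing with \<delta>\<close>

lemma d_pairing_simple_reflection [simp]: "d \<cdot> simple_reflection adj i \<mu> = d \<cdot> \<mu>"
  by (simp add: pairing_simple_reflection root_reflection_def)

lemma d_pairing_word_product [simp]: "d \<cdot> word_product adj is \<mu> = d \<cdot> \<mu>"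
  by (induction "is") auto

text \<open>\<open>d \<cdot> \<mu>\<close> combines the nonnegative simple values with positive
  coefficients, so it vanishes only if all of them do.\<close>

lemma dominant_d_pairing_eq_0:
  assumes "dominant \<mu>" and "d \<cdot> \<mu> = 0"
  shows "\<mu> = 0"
proof -
  have "simple_root i \<cdot> \<mu> = 0" for i
  proof -
    have "\<forall>i\<in>UNIV. d $ i * (simple_root i \<cdot> \<mu>) = 0"
      using assms d_pos
      by (subst sum_nonneg_eq_0_iff[symmetric])
         (auto simp: dominant_def less_imp_le simp flip: pairing_expansion)
    then show ?thesis
      using d_pos[of i] by (metis UNIV_I less_irrefl mult_eq_0_iff)
  qed
  then show ?thesis
    by (intro weight_eqI) (subst (1) pairing_expansion, simp)
qed

section \<open>Negative roots of a weight\<close>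

text \<open>Its cardinality acts as a length function measuring how far \<mu> is from being
  dominant.\<close>

definition negative_roots :: "'v weight \<Rightarrow> (int ^ 'v) set" where
  "negative_roots \<mu> = {\<alpha> \<in> positive_real_roots adj. \<alpha> \<cdot> \<mu> < 0}"

text \<open>A zero at \<open>z\<close> selects one vector from each class modulo \<open>d\<close>.
  The energy bounds the jump of \<open>x / d\<close> along every edge, so bounds on coordinates
  spread from \<open>z\<close> over the connected graph.\<close>

lemma finite_normalized_roots: "finite {x. x $ z = 0 \<and> cartan_form adj x x = 2}" (is "finite ?F")
proof -
  have "\<exists>B. \<forall>x\<in>?F. \<bar>x $ i\<bar> \<le> B" for i
    using connected[of i]
  proof (induction rule: rtranclp_induct)
    case base
    then show ?case by auto
  next
    case (step i j)
    then obtain B where B: "\<And>x. x \<in> ?F \<Longrightarrow> \<bar>x $ i\<bar> \<le> B"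
      by blast
    \<comment> \<open>The energy is 2 * 2 = 4 and the edge weight is at least 1, so
      \<open>x / d\<close> jumps by at most 2.\<close>
    have "\<bar>x $ j\<bar> \<le> d $ j * (B + 2)" if x: "x \<in> ?F" for x
    proof -
      define u where "u = real_of_int (x $ i) / of_int (d $ i)"
      define v where "v = real_of_int (x $ j) / of_int (d $ j)"
      have d: "1 \<le> real_of_int (d $ i)" "1 \<le> real_of_int (d $ j)"
        using d_pos[of i] d_pos[of j] by linarith+
      have "of_int (d $ i * d $ j) * (u - v)\<^sup>2 \<le> 4"
        using cartan_form_edge_le[OF step.hyps(2), of x] x by (simp add: u_def v_def)
      moreover have "1 * 1 * (u - v)\<^sup>2 \<le> of_int (d $ i * d $ j) * (u - v)\<^sup>2"
        unfolding of_int_mult using d by (intro mult_mono) auto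
      ultimately have "(u - v)\<^sup>2 \<le> 2\<^sup>2"
        by simp
      then have "\<bar>u - v\<bar> \<le> 2"
        by (metis abs_le_square_iff abs_numeral)
      moreover have "\<bar>u\<bar> \<le> \<bar>of_int (x $ i)\<bar>"
        using d(1) by (simp add: u_def abs_divide divide_le_eq mult_ge1_I mult_le_cancel_left1)
      moreover have "\<bar>real_of_int (x $ i)\<bar> \<le> of_int B"
        using B[OF x] by linarith
      ultimately have "\<bar>v\<bar> \<le> of_int B + 2"
        by linarith
      then have "real_of_int (d $ j) * \<bar>v\<bar> \<le> of_int (d $ j) * (of_int B + 2)"
        using d by (intro mult_left_mono) auto
      moreover have "real_of_int (d $ j) * \<bar>v\<bar> = \<bar>of_int (x $ j)\<bar>"
        using d by (simp add: v_def abs_divide)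
      ultimately have "real_of_int \<bar>x $ j\<bar> \<le> of_int (d $ j * (B + 2))"
        by simp
      then show ?thesis
        by (simp only: of_int_le_iff)
    qed
    then show ?case
      by blast
  qed
  then have "\<forall>i. \<exists>B. \<forall>x\<in>?F. \<bar>x $ i\<bar> \<le> B"
    by (rule allI)
  from choice[OF this] obtain B where B: "\<And>i x. x \<in> ?F \<Longrightarrow> \<bar>x $ i\<bar> \<le> B i"
    by blast
  have "vec_nth ` ?F \<subseteq> (\<Pi>\<^sub>E i\<in>UNIV. {- B i..B i})"
    using B by (force simp: PiE_def abs_le_iff minus_le_iff)
  moreover have "finite (\<Pi>\<^sub>E i\<in>UNIV. {- B i..B i})"
    by (intro finite_PiE) auto
  ultimately have "finite (vec_nth ` ?F)"
    by (rule finite_subset)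
  then show ?thesis
    by (rule finite_imageD) (simp add: inj_on_def vec_nth_inject)
qed

text \<open>Modulo \<open>d\<close> there are only finitely many real roots, and adding \<open>d\<close> increases the pairing.\<close>

lemma finite_negative_roots:
  assumes "0 < d \<cdot> \<mu>"
  shows "finite (negative_roots \<mu>)"
proof -
  let ?F = "{x. x $ z = 0 \<and> cartan_form adj x x = 2}"
  have "negative_roots \<mu> \<subseteq> (\<Union>x\<in>?F. (\<lambda>k. x + k *s d) ` {0..\<bar>x \<cdot> \<mu>\<bar>})"
  proof
    fix \<alpha> assume \<alpha>: "\<alpha> \<in> negative_roots \<mu>"
    \<comment> \<open>As \<open>d $ z = 1\<close>, subtracting \<open>k *s d\<close> clears the
      coordinate at \<open>z\<close>.\<close>
    define k where "k = \<alpha> $ z"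
    define x where "x = \<alpha> - k *s d"
    have "0 \<le> k" and neg: "\<alpha> \<cdot> \<mu> < 0" and "cartan_form adj \<alpha> \<alpha> = 2"
      using \<alpha> by (auto simp: negative_roots_def positive_real_roots_def k_def)
    then have "x \<in> ?F"
      by (simp add: x_def k_def d_z cartan_form_bilinear)
    have \<alpha>_eq: "\<alpha> = x + k *s d"
      by (simp add: x_def)
    then have "x \<cdot> \<mu> + k * (d \<cdot> \<mu>) < 0"
      using neg by (simp add: pairing_add_left pairing_scale_left)
    moreover have "k * 1 \<le> k * (d \<cdot> \<mu>)"
      using assms \<open>0 \<le> k\<close> by (intro mult_left_mono) auto
    ultimately have "k \<le> \<bar>x \<cdot> \<mu>\<bar>"
      by linarith
    then show "\<alpha> \<in> (\<Union>x\<in>?F. (\<lambda>k. x + k *s d) ` {0..\<bar>x \<cdot> \<mu>\<bar>})"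
      using \<open>x \<in> ?F\<close> \<open>0 \<le> k\<close> \<alpha>_eq by (intro UN_I image_eqI) auto
  qed
  then show ?thesis
    by (rule finite_subset) (intro finite_UN_I finite_normalized_roots finite_imageI finite_atLeastAtMost_int)
qed

section \<open>Effect of a reflection on the negative roots\<close>

lemma inj_root_reflection: "inj_on (root_reflection adj i) A"
  by (rule inj_on_inverseI) (rule root_reflection_involution)

text \<open>Reflecting both root and weight leaves the pairing unchanged, and only
  \<open>simple_root i\<close> can lose its positivity.\<close>

lemma reflect_negative_roots_subset:
  "root_reflection adj i ` (negative_roots \<mu> - {simple_root i})
    \<subseteq> negative_roots (simple_reflection adj i \<mu>)"
proof
  fix \<beta> assume "\<beta> \<in> root_reflection adj i ` (negative_roots \<mu> - {simple_root i})"
  then obtain \<alpha> where "\<alpha> \<in> negative_roots \<mu>" "\<alpha> \<noteq> simple_root i" and \<beta>: "\<beta> = root_reflection adj i \<alpha>"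
    by blast
  then show "\<beta> \<in> negative_roots (simple_reflection adj i \<mu>)"
    using root_reflection_positive[of \<alpha> i]
    by (simp add: negative_roots_def pairing_simple_reflection root_reflection_involution)
qed

lemma card_negative_roots_le:
  assumes "0 < d \<cdot> \<mu>"
  shows "card (negative_roots \<mu>) \<le> Suc (card (negative_roots (simple_reflection adj i \<mu>)))"
proof -
  have "card (negative_roots \<mu> - {simple_root i}) \<le> card (negative_roots (simple_reflection adj i \<mu>))"
    using card_mono[OF finite_negative_roots reflect_negative_roots_subset[of i \<mu>]] assms
    by (simp add: card_image inj_root_reflection)
  then show ?thesis
    using diff_card_le_card_Diff[of "{simple_root i}" "negative_roots \<mu>"] by simp
qed

text \<open>A lower bound on the length of every word, minuscule or not: each letter removes at most
  one negative root.\<close>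

lemma card_negative_roots_word_product:
  assumes "0 < d \<cdot> \<mu>"
  shows "card (negative_roots \<mu>) \<le> length is + card (negative_roots (word_product adj is \<mu>))"
proof (induction "is")
  case (Cons i "is")
  then show ?case
    using card_negative_roots_le[of "word_product adj is \<mu>" i] assms by simp
qed simp

text \<open>Here \<open>simple_root i\<close> is itself negative on \<mu> and positive on the
  reflected weight. It is the one root lost, and the inclusion above becomes an equality.\<close>

lemma card_negative_roots_reflect:
  assumes "0 < d \<cdot> \<mu>" and neg: "simple_root i \<cdot> \<mu> < 0"
  shows "card (negative_roots \<mu>) = Suc (card (negative_roots (simple_reflection adj i \<mu>)))"
proof -
  have simple: "simple_root i \<in> negative_roots \<mu>"
    using neg simple_root_positive by (simp add: negative_roots_def)
  have refl_simple: "root_reflection adj i (simple_root i) = - simple_root i"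
    by (simp add: root_reflection_def cartan_form_simple_root_self vec_eq_iff)
  have "negative_roots (simple_reflection adj i \<mu>)
      \<subseteq> root_reflection adj i ` (negative_roots \<mu> - {simple_root i})"
  proof
    fix \<alpha> assume "\<alpha> \<in> negative_roots (simple_reflection adj i \<mu>)"
    then have \<alpha>: "\<alpha> \<in> positive_real_roots adj" "root_reflection adj i \<alpha> \<cdot> \<mu> < 0"
      by (simp_all add: negative_roots_def pairing_simple_reflection)
    have "\<alpha> \<noteq> simple_root i"
      using \<alpha>(2) neg by (auto simp: refl_simple pairing_minus_left)
    then have "root_reflection adj i \<alpha> \<in> negative_roots \<mu>"
      using \<alpha> root_reflection_positive by (simp add: negative_roots_def)
    moreover have "root_reflection adj i \<alpha> \<noteq> simple_root i"
    proof
      assume "root_reflection adj i \<alpha> = simple_root i"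
      then have "\<alpha> = - simple_root i"
        by (metis refl_simple root_reflection_involution)
      then have "\<alpha> $ i = -1"
        by simp
      moreover have "0 \<le> \<alpha> $ i"
        using \<alpha>(1) by (simp add: positive_real_roots_def)
      ultimately show False
        by simp
    qed
    ultimately show "\<alpha> \<in> root_reflection adj i ` (negative_roots \<mu> - {simple_root i})"
      by (intro image_eqI[of _ _ "root_reflection adj i \<alpha>"]) (simp_all add: root_reflection_involution)
  qed
  then have "card (negative_roots (simple_reflection adj i \<mu>)) = card (negative_roots \<mu> - {simple_root i})"
    using reflect_negative_roots_subset[of i \<mu>]
    by (metis card_image inj_root_reflection subset_antisym)
  then show ?thesis
    using simple finite_negative_roots[OF assms(1)] by (metis card_Suc_Diff1)
qed

section \<open>Minuscule words\<close>

definition bounded_weight :: "'v weight \<Rightarrow> bool" where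
  "bounded_weight \<mu> \<longleftrightarrow> (\<forall>\<alpha> \<in> positive_real_roots adj. \<alpha> \<cdot> \<mu> \<ge> -1)"

text \<open>The other positive roots are permuted, so only the value at \<open>simple_root i\<close>
  needs checking. This serves both to make a move and to undo one.\<close>

lemma bounded_weight_reflect:
  assumes "bounded_weight \<mu>" and "simple_root i \<cdot> simple_reflection adj i \<mu> \<ge> -1"
  shows "bounded_weight (simple_reflection adj i \<mu>)"
  unfolding bounded_weight_def
proof
  fix \<alpha> assume "\<alpha> \<in> positive_real_roots adj"
  then show "\<alpha> \<cdot> simple_reflection adj i \<mu> \<ge> -1"
    using assms root_reflection_positive[of \<alpha> i]
    by (cases "\<alpha> = simple_root i") (auto simp: bounded_weight_def pairing_simple_reflection)
qed

lemma bounded_weight_of_minuscule_word: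
  assumes "minuscule_word adj \<mu> is" and "bounded_weight (word_product adj is \<mu>)"
  shows "bounded_weight \<mu>"
  using assms
proof (induction "is")
  case (Cons i "is")
  \<comment> \<open>Undoing the letter \<open>i\<close> restores the value -1 at
    \<open>simple_root i\<close>, which the bound just allows.\<close>
  have "bounded_weight (simple_reflection adj i (word_product adj (i # is) \<mu>))"
    using Cons.prems
    by (intro bounded_weight_reflect) (simp_all add: simple_reflection_involution)
  then show ?case
    using Cons by (simp add: simple_reflection_involution)
qed simp

lemma bounded_weight_d_pairing:
  assumes "bounded_weight \<mu>"
  shows "0 \<le> d \<cdot> \<mu>"
proof (rule ccontr)
  assume "\<not> 0 \<le> d \<cdot> \<mu>"
  \<comment> \<open>If \<open>d \<cdot> \<mu> \<le> -1\<close>, this \<open>k\<close> pushes the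
    value of \<open>simple_root z + k *s d\<close> down to at most -2.\<close>
  define k where "k = \<bar>simple_root z \<cdot> \<mu>\<bar> + 2"
  have "-1 \<le> (simple_root z + k *s d) \<cdot> \<mu>"
    using assms add_multiple_d_positive[OF simple_root_positive, of k z]
    by (simp add: bounded_weight_def k_def)
  then have "-1 \<le> simple_root z \<cdot> \<mu> + k * (d \<cdot> \<mu>)"
    by (simp add: pairing_add_left pairing_scale_left)
  moreover have "k * (d \<cdot> \<mu>) \<le> k * (-1)"
    using \<open>\<not> 0 \<le> d \<cdot> \<mu>\<close> by (intro mult_left_mono) (auto simp: k_def)
  ultimately show False
    by (simp add: k_def)
qed

text \<open>The equation between cardinalities is carried along as the certificate that the word is
  reduced.\<close>

lemma exists_minuscule_word:
  assumes "bounded_weight \<mu>" and "0 < d \<cdot> \<mu>"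
  shows "\<exists>is. minuscule_word adj \<mu> is \<and> dominant (word_product adj is \<mu>) \<and>
    card (negative_roots \<mu>) = length is + card (negative_roots (word_product adj is \<mu>))"
  using assms
proof (induction "card (negative_roots \<mu>)" arbitrary: \<mu> rule: less_induct)
  case less
  show ?case
  proof (cases "dominant \<mu>")
    case True
    then show ?thesis
      by (intro exI[of _ "[]"]) simp
  next
    case False
    then obtain i where neg: "simple_root i \<cdot> \<mu> < 0"
      by (auto simp: dominant_def not_le)
    moreover have "-1 \<le> simple_root i \<cdot> \<mu>"
      using less.prems(1) simple_root_positive by (simp add: bounded_weight_def)
    ultimately have i: "simple_root i \<cdot> \<mu> = -1"
      by simp
    have card: "card (negative_roots \<mu>) = Suc (card (negative_roots (simple_reflection adj i \<mu>)))"
      using card_negative_roots_reflect less.prems(2) neg by blast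
    have "bounded_weight (simple_reflection adj i \<mu>)"
      using less.prems(1) i
      by (intro bounded_weight_reflect) (simp_all add: simple_reflection_def cartan_form_simple_root_self)
    then obtain "is" where "minuscule_word adj (simple_reflection adj i \<mu>) is"
        "dominant (word_product adj is (simple_reflection adj i \<mu>))"
        "card (negative_roots (simple_reflection adj i \<mu>)) = length is +
          card (negative_roots (word_product adj is (simple_reflection adj i \<mu>)))"
      using less.hyps[of "simple_reflection adj i \<mu>"] card less.prems(2) by auto
    \<comment> \<open>The new letter goes to the right end, since it acts first.\<close>
    then show ?thesis
      using i card
      by (intro exI[of _ "is @ [i]"]) (simp add: minuscule_word_append word_product_append)
  qed
qed

lemma exists_minuscule_element:
  assumes "bounded_weight \<mu>" and "d \<cdot> \<mu> \<noteq> 0"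
  shows "\<exists>w \<in> weyl_group adj. minuscule adj \<mu> w \<and> dominant (w \<mu>)"
proof -
  have pos: "0 < d \<cdot> \<mu>"
    using bounded_weight_d_pairing[OF assms(1)] assms(2) by simp
  obtain "is" where "is": "minuscule_word adj \<mu> is" "dominant (word_product adj is \<mu>)"
      "card (negative_roots \<mu>) = length is + card (negative_roots (word_product adj is \<mu>))"
    using exists_minuscule_word[OF assms(1) pos] by blast
  \<comment> \<open>Equal products have the same end weight, so the lower bound for
    \<open>js\<close> meets the exact count for \<open>is\<close>.\<close>
  have "length is \<le> length js" if "word_product adj js = word_product adj is" for js
    using card_negative_roots_word_product[OF pos, of js] that "is"(3) by simp
  then have "minuscule adj \<mu> (word_product adj is)"
    using "is"(1) by (auto simp: minuscule_iff reduced_expression_def)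
  then show ?thesis
    using "is"(2) word_product_in_weyl_group by blast
qed

theorem minuscule_dominant_iff:
  assumes "\<mu> \<noteq> 0"
  shows "(\<exists>w \<in> weyl_group adj. minuscule adj \<mu> w \<and> dominant (w \<mu>)) \<longleftrightarrow>
    (\<forall>\<alpha> \<in> positive_real_roots adj. \<alpha> \<cdot> \<mu> \<ge> -1) \<and> delta adj \<cdot> \<mu> \<noteq> 0"
proof
  assume "\<exists>w \<in> weyl_group adj. minuscule adj \<mu> w \<and> dominant (w \<mu>)"
  then obtain "is" where "is": "minuscule_word adj \<mu> is" and dom: "dominant (word_product adj is \<mu>)"
    by (auto simp: minuscule_iff reduced_expression_def)
  have "bounded_weight (word_product adj is \<mu>)"
    using dominant_pairing_nonneg[OF dom]
    by (force simp: bounded_weight_def positive_real_roots_def)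
  then have "bounded_weight \<mu>"
    by (rule bounded_weight_of_minuscule_word[OF "is"])
  \<comment> \<open>Otherwise, by invariance, the dominant end weight vanishes on \<open>d\<close>,
    so it is 0 and \<mu> = 0.\<close>
  moreover have "d \<cdot> \<mu> \<noteq> 0"
    using dominant_d_pairing_eq_0[OF dom] word_product_eq_0 assms by auto
  ultimately show "(\<forall>\<alpha> \<in> positive_real_roots adj. \<alpha> \<cdot> \<mu> \<ge> -1) \<and> delta adj \<cdot> \<mu> \<noteq> 0"
    by (simp add: bounded_weight_def delta_eq)
next
  assume "(\<forall>\<alpha> \<in> positive_real_roots adj. \<alpha> \<cdot> \<mu> \<ge> -1) \<and> delta adj \<cdot> \<mu> \<noteq> 0"
  then show "\<exists>w \<in> weyl_group adj. minuscule adj \<mu> w \<and> dominant (w \<mu>)"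
    by (intro exists_minuscule_element) (auto simp: bounded_weight_def delta_eq)
qed

end

section \<open>The extended Dynkin graphs\<close>

abbreviation joined :: "(nat \<times> nat) set \<Rightarrow> nat \<Rightarrow> nat \<Rightarrow> bool" where
  "joined D a b \<equiv> (a, b) \<in> D \<or> (b, a) \<in> D"

text \<open>
  The \<open>m a\<close> are the coefficients of \<open>\<delta>\<close>. Connectedness is certified by a rank \<open>r\<close> that decreases
  along some edge at every vertex except \<open>0\<close>.
\<close>

lemma affine_graph_of_shape:
  fixes adj :: "'v::finite \<Rightarrow> 'v \<Rightarrow> bool" and m :: "nat \<Rightarrow> int" and r :: "nat \<Rightarrow> nat"
  assumes shape: "graph_of_shape adj n D"
    and irrefl: "\<And>a. a \<le> n \<Longrightarrow> (a, a) \<notin> D"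
    and m_pos: "\<And>a. a \<le> n \<Longrightarrow> 0 < m a"
    and m_0: "m 0 = 1"
    and harmonic: "\<And>a. a \<le> n \<Longrightarrow> (\<Sum>b | b \<le> n \<and> joined D a b. m b) = 2 * m a"
    and rank: "\<And>a. a \<le> n \<Longrightarrow> a \<noteq> 0 \<Longrightarrow> \<exists>b\<le>n. joined D a b \<and> r b < r a"
  shows "\<exists>z d. affine_graph adj z d"
proof -
  obtain f where f: "bij_betw f UNIV {0..n}" and adj: "\<And>i j. adj i j \<longleftrightarrow> joined D (f i) (f j)"
    using shape unfolding graph_of_shape_def by blast
  define g where "g = inv_into UNIV f"
  have f_le: "f i \<le> n" for i
    using bij_betwE[OF f] by simp
  have f_g: "f (g b) = b" if "b \<le> n" for b
    using bij_betw_inv_into_right[OF f, of b] that by (simp add: g_def)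
  have g_f: "g (f i) = i" for i
    using bij_betw_inv_into_left[OF f, of i] by (simp add: g_def)
  have "affine_graph adj (g 0) (\<chi> i. m (f i))"
  proof
    fix i j
    show "adj j i" if "adj i j"
      using that adj by blast
    show "\<not> adj i i"
      using irrefl f_le by (simp add: adj)
    show "0 < (\<chi> i. m (f i)) $ i"
      using m_pos f_le by simp
    show "(\<chi> i. m (f i)) $ g 0 = 1"
      by (simp add: f_g m_0)
    have "bij_betw f {j. adj i j} {b. b \<le> n \<and> joined D (f i) b}"
      using f_le f_g g_f by (intro bij_betw_byWitness[where f' = g]) (auto simp: adj)
    then have "(\<Sum>j | adj i j. m (f j)) = (\<Sum>b | b \<le> n \<and> joined D (f i) b. m b)"
      by (rule sum.reindex_bij_betw)
    then show "(\<Sum>j | adj i j. (\<chi> i. m (f i)) $ j) = 2 * (\<chi> i. m (f i)) $ i"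
      using harmonic[OF f_le] by simp
    show "adj\<^sup>*\<^sup>* (g 0) i"
    proof (induction "r (f i)" arbitrary: i rule: less_induct)
      case less
      show ?case
      proof (cases "f i = 0")
        case True
        then show ?thesis
          using g_f[of i] by simp
      next
        case False
        then obtain b where b: "b \<le> n" "joined D (f i) b" "r b < r (f i)"
          using rank f_le by blast
        then have "adj\<^sup>*\<^sup>* (g 0) (g b)" and "adj (g b) i"
          using less[of "g b"] by (auto simp: f_g adj)
        then show ?thesis
          by (rule rtranclp.rtrancl_into_rtrancl)
      qed
    qed
  qed
  then show ?thesis
    by blast
qed

lemma affine_graph_A:
  assumes "graph_of_shape adj n (edges_A n)" and "2 \<le> n"
  shows "\<exists>z d. affine_graph adj z d"
proof (rule affine_graph_of_shape[OF assms(1), of "\<lambda>_. 1" "\<lambda>a. a"])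
  have edge: "(a, b) \<in> edges_A n \<longleftrightarrow> a \<le> n \<and> b = (if a = n then 0 else a + 1)" for a b
    by (auto simp: edges_A_def)
  fix a assume "a \<le> n"
  then show "(a, a) \<notin> edges_A n"
    using assms(2) by (auto simp: edge)
  \<comment> \<open>In each case the two listed neighbours are distinct because
    \<open>2 \<le> n\<close>.\<close>
  have "{b. b \<le> n \<and> joined (edges_A n) a b} =
      (if a = 0 then {1, n} else if a = n then {0, n - 1} else {a - 1, a + 1})"
    using \<open>a \<le> n\<close> assms(2) by (auto simp: edge split: if_splits)
  then show "(\<Sum>b | b \<le> n \<and> joined (edges_A n) a b. 1) = 2 * (1::int)"
    using assms(2) by auto
  show "\<exists>b\<le>n. joined (edges_A n) a b \<and> b < a" if "a \<noteq> 0"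
    using that \<open>a \<le> n\<close> by (intro exI[of _ "a - 1"]) (auto simp: edge)
qed simp_all

lemma affine_graph_D:
  assumes "graph_of_shape adj n (edges_D n)" and "4 \<le> n"
  shows "\<exists>z d. affine_graph adj z d"
proof -
  obtain k where n: "n = k + 4"
    using assms(2) by (metis add.commute le_Suc_ex)
  let ?D = "edges_D (k + 4)"
  \<comment> \<open>Coefficient 1 at the four leaves, 2 elsewhere.\<close>
  define m :: "nat \<Rightarrow> int" where "m a = (if a \<in> {0, 1, k + 3, k + 4} then 1 else 2)" for a
  \<comment> \<open>Vertex 1 is reached from 0 only through 2, so the ranks of 1 and 2 are
    exchanged.\<close>
  define r where "r a = (if a = 0 then 0 else if a = 2 then 1 else if a = 1 then 2 else a)" for a :: nat
  have edge: "(a, b) \<in> ?D \<longleftrightarrow>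
      a = 0 \<and> b = 2 \<or> a = k + 2 \<and> b = k + 4 \<or> 1 \<le> a \<and> a \<le> k + 2 \<and> b = a + 1" for a b
    by (auto simp: edges_D_def)
  show ?thesis
  proof (rule affine_graph_of_shape[OF assms(1)[unfolded n], of m r])
    fix a assume "a \<le> k + 4"
    show "(a, a) \<notin> ?D"
      by (auto simp: edge)
    show "0 < m a"
      by (simp add: m_def)
    \<comment> \<open>For \<open>k = 0\<close> the two branch vertices coincide and the graph is a
      star with four leaves.\<close>
    consider "a = 0" | "a = 1" | "a = 2" "k = 0" | "a = 2" "0 < k" | "3 \<le> a" "a < k + 2"
      | "a = k + 2" "0 < k" | "a = k + 3" | "a = k + 4"
      using \<open>a \<le> k + 4\<close> by linarith
    then show "(\<Sum>b | b \<le> k + 4 \<and> joined ?D a b. m b) = 2 * m a"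
    proof cases
      case 1
      then have "{b. b \<le> k + 4 \<and> joined ?D a b} = {2}"
        unfolding edge by auto
      then show ?thesis
        using 1 by (simp add: m_def)
    next
      case 2
      then have "{b. b \<le> k + 4 \<and> joined ?D a b} = {2}"
        unfolding edge by auto
      then show ?thesis
        using 2 by (simp add: m_def)
    next
      case 3
      then have "{b. b \<le> k + 4 \<and> joined ?D a b} = {0, 1, 3, 4}"
        unfolding edge by auto
      then show ?thesis
        using 3 by (simp add: m_def)
    next
      case 4
      then have "{b. b \<le> k + 4 \<and> joined ?D a b} = {0, 1, 3}"
        unfolding edge by auto
      then show ?thesis
        using 4 by (simp add: m_def)
    next
      case 5
      then have "{b. b \<le> k + 4 \<and> joined ?D a b} = {a - 1, a + 1}"
        unfolding edge by auto
      then show ?thesis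
        using 5 by (simp add: m_def, arith)
    next
      case 6
      then have "{b. b \<le> k + 4 \<and> joined ?D a b} = {k + 1, k + 3, k + 4}"
        unfolding edge by auto
      then show ?thesis
        using 6 by (simp add: m_def)
    next
      case 7
      then have "{b. b \<le> k + 4 \<and> joined ?D a b} = {k + 2}"
        unfolding edge by auto
      then show ?thesis
        using 7 by (simp add: m_def)
    next
      case 8
      then have "{b. b \<le> k + 4 \<and> joined ?D a b} = {k + 2}"
        unfolding edge by auto
      then show ?thesis
        using 8 by (simp add: m_def)
    qed
    assume "a \<noteq> 0"
    then consider "a = 1" | "a = 2" | "a = k + 4" | "3 \<le> a" "a \<le> k + 3"
      using \<open>a \<le> k + 4\<close> by linarith
    then show "\<exists>b\<le>k + 4. joined ?D a b \<and> r b < r a"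
    proof cases
      case 1
      then show ?thesis
        by (intro exI[of _ 2]) (simp add: edge r_def)
    next
      case 2
      then show ?thesis
        by (intro exI[of _ 0]) (simp add: edge r_def)
    next
      case 3
      then show ?thesis
        by (intro exI[of _ "k + 2"]) (simp add: edge r_def)
    next
      case 4
      then show ?thesis
        by (intro exI[of _ "a - 1"]) (auto simp: edge r_def)
    qed
  qed (simp add: m_def)
qed

text \<open>Here and for the other two exceptional types, the first list holds the coefficients of
  \<delta> and the second the distances to vertex 0 in the tree.\<close>

lemma affine_graph_E6:
  assumes "graph_of_shape adj 6 edges_E6"
  shows "\<exists>z d. affine_graph adj z d"
proof (rule affine_graph_of_shape[OF assms,
      of "(!) [1::int, 1, 2, 2, 3, 2, 1]" "(!) [0, 4, 1, 3, 2, 3, 4]"])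
  fix a :: nat assume "a \<le> 6"
  then have a: "a \<in> {0, 1, 2, 3, 4, 5, 6}"
    by auto
  show "(a, a) \<notin> edges_E6"
    by (auto simp: edges_E6_def)
  show "0 < [1::int, 1, 2, 2, 3, 2, 1] ! a"
    using a by auto
  show "(\<Sum>b | b \<le> 6 \<and> joined edges_E6 a b. [1::int, 1, 2, 2, 3, 2, 1] ! b) = 2 * [1::int, 1, 2, 2, 3, 2, 1] ! a"
    unfolding atMost_iff[symmetric] sum.inter_filter[OF finite_atMost]
    using a by (auto simp: edges_E6_def numeral_eq_Suc)
  \<comment> \<open>The witness list gives each vertex its neighbour on the path to 0; the entry at
    0 is a dummy.\<close>
  show "\<exists>b\<le>6. joined edges_E6 a b \<and> [0::nat, 4, 1, 3, 2, 3, 4] ! b < [0, 4, 1, 3, 2, 3, 4] ! a" if "a \<noteq> 0"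
    using a that
    by - (rule exI[of _ "[0, 3, 0, 4, 2, 4, 5] ! a"], elim insertE emptyE; simp add: edges_E6_def)
qed simp_all

lemma affine_graph_E7:
  assumes "graph_of_shape adj 7 edges_E7"
  shows "\<exists>z d. affine_graph adj z d"
proof (rule affine_graph_of_shape[OF assms,
      of "(!) [1::int, 2, 2, 3, 4, 3, 2, 1]" "(!) [0, 1, 4, 2, 3, 4, 5, 6]"])
  fix a :: nat assume "a \<le> 7"
  then have a: "a \<in> {0, 1, 2, 3, 4, 5, 6, 7}"
    by auto
  show "(a, a) \<notin> edges_E7"
    by (auto simp: edges_E7_def)
  show "0 < [1::int, 2, 2, 3, 4, 3, 2, 1] ! a"
    using a by auto
  show "(\<Sum>b | b \<le> 7 \<and> joined edges_E7 a b. [1::int, 2, 2, 3, 4, 3, 2, 1] ! b) = 2 * [1::int, 2, 2, 3, 4, 3, 2, 1] ! a"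
    unfolding atMost_iff[symmetric] sum.inter_filter[OF finite_atMost]
    using a by (auto simp: edges_E7_def numeral_eq_Suc)
  show "\<exists>b\<le>7. joined edges_E7 a b \<and> [0::nat, 1, 4, 2, 3, 4, 5, 6] ! b < [0, 1, 4, 2, 3, 4, 5, 6] ! a" if "a \<noteq> 0"
    using a that
    by - (rule exI[of _ "[0, 0, 4, 1, 3, 4, 5, 6] ! a"], elim insertE emptyE; simp add: edges_E7_def)
qed simp_all

lemma affine_graph_E8:
  assumes "graph_of_shape adj 8 edges_E8"
  shows "\<exists>z d. affine_graph adj z d"
proof (rule affine_graph_of_shape[OF assms,
      of "(!) [1::int, 2, 3, 4, 6, 5, 4, 3, 2]" "(!) [0, 7, 6, 6, 5, 4, 3, 2, 1]"])
  fix a :: nat assume "a \<le> 8"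
  then have a: "a \<in> {0, 1, 2, 3, 4, 5, 6, 7, 8}"
    by auto
  show "(a, a) \<notin> edges_E8"
    by (auto simp: edges_E8_def)
  show "0 < [1::int, 2, 3, 4, 6, 5, 4, 3, 2] ! a"
    using a by auto
  show "(\<Sum>b | b \<le> 8 \<and> joined edges_E8 a b. [1::int, 2, 3, 4, 6, 5, 4, 3, 2] ! b) = 2 * [1::int, 2, 3, 4, 6, 5, 4, 3, 2] ! a"
    unfolding atMost_iff[symmetric] sum.inter_filter[OF finite_atMost]
    using a by (auto simp: edges_E8_def numeral_eq_Suc)
  show "\<exists>b\<le>8. joined edges_E8 a b \<and> [0::nat, 7, 6, 6, 5, 4, 3, 2, 1] ! b < [0, 7, 6, 6, 5, 4, 3, 2, 1] ! a" if "a \<noteq> 0"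
    using a that
    by - (rule exI[of _ "[0, 3, 4, 4, 5, 6, 7, 8, 0] ! a"], elim insertE emptyE; simp add: edges_E8_def)
qed simp_all

lemma affine_graph_of_extended_Dynkin:
  assumes "simply_laced_extended_Dynkin adj"
  shows "\<exists>z d. affine_graph adj z d"
  using assms affine_graph_A affine_graph_D affine_graph_E6 affine_graph_E7 affine_graph_E8
  unfolding simply_laced_extended_Dynkin_def by blast

theorem theorem1p3:
  fixes adj :: "'v::finite \<Rightarrow> 'v \<Rightarrow> bool" and \<mu> :: "'v weight"
  assumes "simply_laced_extended_Dynkin adj"
    and "\<mu> \<noteq> 0"
  shows "(\<exists>w \<in> weyl_group adj. minuscule adj \<mu> w \<and> dominant (w \<mu>)) \<longleftrightarrow>
           (\<forall>\<alpha> \<in> positive_real_roots adj. \<alpha> \<cdot> \<mu> \<ge> -1) \<and> delta adj \<cdot> \<mu> \<noteq> 0"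
proof -
  obtain z d where "affine_graph adj z d"
    using affine_graph_of_extended_Dynkin[OF assms(1)] by blast
  then show ?thesis
    using assms(2) by (rule affine_graph.minuscule_dominant_iff)
qed

end
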